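(* Let $\Phi:\mathcal{M}_q^2\to\mathcal{M}_p$ be a unital positive multilinear map. Let $0<m\leq M$ be scalars and let $A_i,B_i\in\mathcal{M}_q$ $(i=1,\ldots,n)$ be positive matrices with $mI\leq A_i\leq MI$ and $mI\leq B_i\leq MI$. Then for all positive matrices $X_i,Y_i\in\mathcal{M}_q$ $(i=1,\ldots,n)$, $$\Phi\left(\sum_{i=1}^{n}X_i^{\frac12}A_iX_i^{\frac12},\sum_{i=1}^{n}Y_i^{\frac12}B_i^{-1}Y_i^{\frac12}\right)+\Phi\left(\sum_{i=1}^{n}X_i^{\frac12}A_i^{-1}X_i^{\frac12},\sum_{i=1}^{n}Y_i^{\frac12}B_iY_i^{\frac12}\right)\leq\frac{m^2+M^2}{mM}\,\Phi\left(\sum_{i=1}^{n}X_i,\sum_{i=1}^{n}Y_i\right).$$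
   Context: $\mathcal{M}_p$ is the algebra of $p\times p$ complex matrices with identity $I$. A matrix $A$ is positive ($A\geq0$) if it is Hermitian with all eigenvalues nonnegative; $A\leq B$ means $B-A\geq0$. A map $\Phi:\mathcal{M}_q^2\to\mathcal{M}_p$ is multilinear if it is linear in each of its variables; positive if $\Phi(A,B)\geq0$ whenever $A,B\geq0$; unital if $\Phi(I,I)=I$. *)

theory Defs
  imports "HOL-Analysis.Analysis"
begin

text \<open>
  Matrices of order \<open>CARD('n)\<close> over the complex numbers are elements of
  \<open>complex ^ 'n ^ 'n\<close>.
\<close>

definition mat_scale :: "complex \<Rightarrow> complex ^ 'n ^ 'm \<Rightarrow> complex ^ 'n ^ 'm" where
  "mat_scale c A = (\<chi> i j. c * A $ i $ j)"

interpretation cmat: vector_space "mat_scale :: complex \<Rightarrow> complex ^ 'n ^ 'm \<Rightarrow> complex ^ 'n ^ 'm"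
  by unfold_locales (simp_all add: mat_scale_def vec_eq_iff algebra_simps)

definition hermitian :: "complex ^ 'n ^ 'n \<Rightarrow> bool" where
  "hermitian A \<longleftrightarrow> (\<forall>i j. A $ i $ j = cnj (A $ j $ i))"

definition mat_eigenvalue :: "complex ^ 'n ^ 'n \<Rightarrow> complex \<Rightarrow> bool" where
  "mat_eigenvalue A c \<longleftrightarrow> (\<exists>v. v \<noteq> 0 \<and> A *v v = c *s v)"

definition positive_mat :: "complex ^ 'n ^ 'n \<Rightarrow> bool" where
  "positive_mat A \<longleftrightarrow> hermitian A \<and> (\<forall>c. mat_eigenvalue A c \<longrightarrow> c \<in> \<real>\<^sub>\<ge>\<^sub>0)"

text \<open>
  This is not the componentwise order that the type \<open>complex ^ 'n ^ 'n\<close> would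
  inherit from an order on its entries.
\<close>

definition loewner_le :: "complex ^ 'n ^ 'n \<Rightarrow> complex ^ 'n ^ 'n \<Rightarrow> bool"
    (infix \<open>\<le>\<^sub>L\<close> 50) where
  "A \<le>\<^sub>L B \<longleftrightarrow> positive_mat (B - A)"

text \<open>The unique positive square root; meaningful for positive arguments only.\<close>

definition mat_sqrt :: "complex ^ 'n ^ 'n \<Rightarrow> complex ^ 'n ^ 'n" where
  "mat_sqrt X = (THE S. positive_mat S \<and> S ** S = X)"

text \<open>
  Maps of two matrix variables are written in curried form.  Linearity in each
  variable is over the complex numbers.
\<close>

definition multilinear_map ::
    "(complex ^ 'q ^ 'q \<Rightarrow> complex ^ 'q ^ 'q \<Rightarrow> complex ^ 'p ^ 'p) \<Rightarrow> bool" where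
  "multilinear_map \<Phi> \<longleftrightarrow>
     (\<forall>B. Vector_Spaces.linear mat_scale mat_scale (\<lambda>A. \<Phi> A B)) \<and>
     (\<forall>A. Vector_Spaces.linear mat_scale mat_scale (\<lambda>B. \<Phi> A B))"

definition positive_map ::
    "(complex ^ 'q ^ 'q \<Rightarrow> complex ^ 'q ^ 'q \<Rightarrow> complex ^ 'p ^ 'p) \<Rightarrow> bool" where
  "positive_map \<Phi> \<longleftrightarrow>
     (\<forall>A B. positive_mat A \<longrightarrow> positive_mat B \<longrightarrow> positive_mat (\<Phi> A B))"

definition unital_map ::
    "(complex ^ 'q ^ 'q \<Rightarrow> complex ^ 'q ^ 'q \<Rightarrow> complex ^ 'p ^ 'p) \<Rightarrow> bool" where
  "unital_map \<Phi> \<longleftrightarrow> \<Phi> (mat 1) (mat 1) = mat 1"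

end

theory Submission
  imports Defs
begin

text \<open>
  Write \<open>P\<close>, \<open>P'\<close> and \<open>U\<close> for the sums over \<open>i\<close> of \<open>R\<^sub>i G R\<^sub>i\<close>, where \<open>R\<^sub>i\<close> is
  the square root of \<open>X\<^sub>i\<close> and \<open>G\<close> is equal to \<open>A\<^sub>i\<close>, to the inverse of \<open>A\<^sub>i\<close>
  and to the identity, and \<open>Q\<close>, \<open>Q'\<close>, \<open>V\<close> for the same sums built from
  \<open>Y\<^sub>i\<close> and \<open>B\<^sub>i\<close>.  The asserted inequality is linear in each of the two triples, and its two sides
  differ by a combination, with positive coefficients, of values of \<open>\<Phi>\<close> at pairs of positive matrices.

  The scalar model shows which ones.  For \<open>a\<close>, \<open>b\<close> in \<open>[m, M]\<close> one has

  \<open>(m\<^sup>2 + M\<^sup>2)/(mM) - a/b - b/a = (a-m)(M-a)/a \<cdot> 1/b + 1/a \<cdot> (b-m)(M-b)/b\<close>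
  \<open>+ (M/m) \<cdot> (1 - m/a) \<cdot> (1 - m/b) + (m/M) \<cdot> (M/a - 1) \<cdot> (M/b - 1)\<close>,

  where every summand is a product of a nonnegative function of \<open>a\<close> and a nonnegative function of \<open>b\<close>.
  Since \<open>(a-m)(M-a)/a = (m+M) - mM/a - a\<close>, each factor is a linear combination of \<open>a\<close>, \<open>1/a\<close> and \<open>1\<close>,
  so replacing \<open>a\<close>, \<open>1/a\<close>, \<open>1\<close> by \<open>P\<close>, \<open>P'\<close>, \<open>U\<close> and \<open>b\<close>, \<open>1/b\<close>, \<open>1\<close> by \<open>Q\<close>, \<open>Q'\<close>, \<open>V\<close> turns the
  identity into one between values of the bilinear map \<open>\<Phi>\<close>.  The factors remain positive:
  \<open>positive_inverse_bounds\<close> treats a single matrix, and congruence by \<open>R\<^sub>i\<close> and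
  summation give \<open>positive_congruence_sum_bounds\<close>.

  Two facts of linear algebra support this: positivity, which is given by eigenvalues, is the same as
  nonnegativity of the quadratic form (\<open>positive_mat_iff_form\<close>), and a positive matrix has exactly one
  positive square root (\<open>positive_sqrt_exists\<close>, \<open>positive_sqrt_unique\<close>).  Both come from
  \<open>max_eigenvector\<close>: a maximiser of the quadratic form on the unit sphere is an eigenvector.

  Throughout, \<open>x \<bullet> y\<close> is the real part of the Hermitian inner product.
\<close>

section \<open>Complex matrices and the real inner product\<close>

lemma scaleR_vec_smult: "r *\<^sub>R v = complex_of_real r *s v" for v :: "complex ^ 'n"
  by (simp add: vec_eq_iff scaleR_conv_of_real[where 'a=complex])

lemma scaleR_mult_vector [simp]: "(r *\<^sub>R A) *v x = r *\<^sub>R (A *v x)"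
  for A :: "complex ^ 'n ^ 'm"
  by (simp add: vec_eq_iff matrix_vector_mult_def scaleR_sum_right)

lemma mult_vector_scaleR [simp]: "A *v (r *\<^sub>R x) = r *\<^sub>R (A *v x)"
  for A :: "complex ^ 'n ^ 'm"
  by (simp add: linear_cmul)

lemma mult_vector_smult: "A *v (c *s x) = c *s (A *v x)" for A :: "complex ^ 'n ^ 'm"
  by (simp add: vec_eq_iff matrix_vector_mult_def sum_distrib_left mult_ac)

lemma mult_vector_uminus [simp]: "(- A) *v x = - (A *v x)" for A :: "complex ^ 'n ^ 'm"
  by (simp add: vec_eq_iff matrix_vector_mult_def sum_negf)

lemma inner_cmult_left: "(a * x) \<bullet> y = x \<bullet> (cnj a * y)" for a x y :: complex
  by (simp add: inner_complex_def algebra_simps)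

lemma inner_smult_left: "(c *s x) \<bullet> y = x \<bullet> (cnj c *s y)" for x y :: "complex ^ 'n"
  by (simp add: inner_vec_def inner_cmult_left)

lemma inner_self_le_zero_iff [simp]: "x \<bullet> x \<le> 0 \<longleftrightarrow> x = 0" for x :: "'a :: real_inner"
  by (metis inner_gt_zero_iff not_le)

text \<open>
  The real part of the Hermitian product determines all of it, because its imaginary part is the real
  part after multiplication by \<open>\<i>\<close>; so self-adjointness for the real inner product is enough.
\<close>

lemma hermitian_iff_self_adjoint:
  "hermitian A \<longleftrightarrow> (\<forall>x y. (A *v x) \<bullet> y = x \<bullet> (A *v y))"
proof
  assume "hermitian A"
  then have h: "cnj (A $ i $ j) = A $ j $ i" for i j
    unfolding hermitian_def by (metis complex_cnj_cnj)
  show "\<forall>x y. (A *v x) \<bullet> y = x \<bullet> (A *v y)"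
  proof (intro allI)
    fix x y
    have "(A *v x) \<bullet> y = (\<Sum>i\<in>UNIV. \<Sum>j\<in>UNIV. x $ j \<bullet> (A $ j $ i * y $ i))"
      by (simp add: inner_vec_def matrix_vector_mult_def inner_sum_left inner_cmult_left h)
    also have "\<dots> = (\<Sum>j\<in>UNIV. \<Sum>i\<in>UNIV. x $ j \<bullet> (A $ j $ i * y $ i))"
      by (rule sum.swap)
    also have "\<dots> = x \<bullet> (A *v y)"
      by (simp add: inner_vec_def matrix_vector_mult_def inner_sum_right)
    finally show "(A *v x) \<bullet> y = x \<bullet> (A *v y)" .
  qed
next
  assume sa: "\<forall>x y. (A *v x) \<bullet> y = x \<bullet> (A *v y)"
  have col: "(A *v axis j c) $ i = A $ i $ j * c" for i j c
    by (simp add: matrix_vector_mult_def axis_def if_distrib cong: if_cong)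
  have e: "(A $ i $ j) \<bullet> c = 1 \<bullet> (A $ j $ i * c)" for i j c
    using sa[rule_format, of "axis j 1" "axis i c"]
    by (simp add: inner_axis inner_axis' col)
  show "hermitian A"
    unfolding hermitian_def
  proof (intro allI)
    fix i j
    show "A $ i $ j = cnj (A $ j $ i)"
      using e[of i j 1] e[of i j \<i>] by (simp add: inner_complex_def complex_eq_iff)
  qed
qed

section \<open>Positivity as nonnegativity of the quadratic form\<close>

text \<open>
  A zero \<open>v\<close> of a nonnegative form minimises it, so the form is stationary at \<open>v\<close>: along \<open>v + t w\<close> the
  coefficient of \<open>t\<close> vanishes.  For \<open>w = K v\<close> this coefficient is twice the squared length of \<open>K v\<close>.
\<close>

lemma null_vector_of_nonneg_form:
  fixes K :: "complex ^ 'n ^ 'n"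
  assumes sa: "\<And>x y. (K *v x) \<bullet> y = x \<bullet> (K *v y)"
    and nonneg: "\<And>x. 0 \<le> x \<bullet> (K *v x)"
    and zero: "v \<bullet> (K *v v) = 0"
  shows "K *v v = 0"
proof -
  define w where "w = K *v v"
  define a where "a = w \<bullet> w"
  define b where "b = w \<bullet> (K *v w)"
  have vKw: "v \<bullet> (K *v w) = a"
    unfolding a_def by (metis sa w_def)
  have q: "0 \<le> t * (2 * a) + t\<^sup>2 * b" for t
    using nonneg[of "v + t *\<^sub>R w"] zero vKw
    by (simp add: a_def b_def w_def[symmetric] matrix_vector_right_distrib inner_add_left inner_add_right
        inner_commute power2_eq_square algebra_simps)
  have "b \<ge> 0" using nonneg unfolding b_def .
  have "a \<le> 0"
  proof (cases "b = 0")
    case True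
    then show ?thesis using q[of "-1"] by simp
  next
    case False
    with \<open>b \<ge> 0\<close> have "b > 0" by simp
    \<comment> \<open>the minimiser of the quadratic polynomial in \<open>t\<close>\<close>
    from q[of "- a / b"] this have "0 \<le> - (a\<^sup>2 / b)"
      by (simp add: power2_eq_square field_simps)
    with \<open>b > 0\<close> show ?thesis
      by (simp add: divide_le_0_iff)
  qed
  then show ?thesis unfolding a_def w_def by simp
qed

text \<open>
  The unit sphere is compact, so the form attains a maximum \<open>l\<close> there, at \<open>v\<close> say.  Then \<open>l - H\<close> has a
  nonnegative form that vanishes at \<open>v\<close>, hence it annihilates \<open>v\<close>.
\<close>

lemma max_eigenvector:
  fixes H :: "complex ^ 'n ^ 'n"
  assumes sa: "\<And>x y. (H *v x) \<bullet> y = x \<bullet> (H *v y)"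
  obtains v l where "norm v = 1" "H *v v = l *\<^sub>R v" "\<And>x. x \<bullet> (H *v x) \<le> l * (x \<bullet> x)"
proof -
  have ne: "sphere (0 :: complex ^ 'n) 1 \<noteq> {}" 
    using vector_choose_size[of 1, where 'a="complex ^ 'n"] by (auto simp: dist_norm)
  have cont: "continuous_on (sphere 0 1) (\<lambda>x. x \<bullet> (H *v x))"
    by (intro continuous_intros linear_continuous_on matrix_vector_mul_bounded_linear)
  obtain v where v: "norm v = 1" and mx: "\<And>y. norm y = 1 \<Longrightarrow> y \<bullet> (H *v y) \<le> v \<bullet> (H *v v)"
    using continuous_attains_sup[OF compact_sphere ne cont] by (auto simp: dist_norm)
  define l where "l = v \<bullet> (H *v v)"
  have le: "x \<bullet> (H *v x) \<le> l * (x \<bullet> x)" for x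
  proof (cases "x = 0")
    case False
    then have "(inverse (norm x) *\<^sub>R x) \<bullet> (H *v (inverse (norm x) *\<^sub>R x)) \<le> l"
      unfolding l_def by (intro mx) simp
    then have "x \<bullet> (H *v x) / (norm x)\<^sup>2 \<le> l"
      by (simp add: power2_eq_square divide_inverse mult_ac)
    then show ?thesis using False by (simp add: divide_le_eq power2_norm_eq_inner)
  qed simp
  define K where "K = l *\<^sub>R mat 1 - H"
  have K: "K *v x = l *\<^sub>R x - H *v x" for x
    unfolding K_def by (simp add: matrix_vector_mult_diff_rdistrib)
  have "K *v v = 0"
  proof (rule null_vector_of_nonneg_form)
    show "v \<bullet> (K *v v) = 0"
      using v by (simp add: K inner_diff_right l_def dot_square_norm)
  qed (use le sa in \<open>simp_all add: K inner_diff_right inner_diff_left\<close>)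
  then have "H *v v = l *\<^sub>R v"
    by (simp add: K)
  with v le show ?thesis
    by (blast intro: that)
qed

text \<open>
  If no eigenvalue is negative, then the largest eigenvalue of \<open>- A\<close> is at most \<open>0\<close>, and it bounds the
  form of \<open>- A\<close>.  Conversely, pairing \<open>A v = c v\<close> with \<open>v\<close> and with \<open>\<i> v\<close> reads off the real and
  the imaginary part of \<open>c\<close>.
\<close>

lemma positive_mat_iff_form:
  "positive_mat A \<longleftrightarrow>
     (\<forall>x y. (A *v x) \<bullet> y = x \<bullet> (A *v y)) \<and> (\<forall>x. 0 \<le> x \<bullet> (A *v x))"
  for A :: "complex ^ 'n ^ 'n"
proof
  assume pos: "positive_mat A"
  then have sa: "\<forall>x y. (A *v x) \<bullet> y = x \<bullet> (A *v y)"
    by (simp add: positive_mat_def hermitian_iff_self_adjoint)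
  obtain v l where v: "norm v = 1" "(- A) *v v = l *\<^sub>R v"
    and le: "\<And>x. x \<bullet> ((- A) *v x) \<le> l * (x \<bullet> x)"
    using max_eigenvector[of "- A"] sa by auto
  have "A *v v = complex_of_real (- l) *s v"
    using v(2) by (simp add: neg_eq_iff_add_eq_0 eq_neg_iff_add_eq_0 flip: scaleR_vec_smult)
  then have "mat_eigenvalue A (complex_of_real (- l))"
    using v(1) unfolding mat_eigenvalue_def by (metis norm_zero zero_neq_one)
  then have "complex_of_real (- l) \<in> \<real>\<^sub>\<ge>\<^sub>0"
    using pos by (auto simp: positive_mat_def)
  then have "l \<le> 0" 
    by (simp add: complex_nonneg_Reals_iff)
  have "0 \<le> x \<bullet> (A *v x)" for x
  proof -
    have "l * (x \<bullet> x) \<le> 0"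
      using \<open>l \<le> 0\<close> by (simp add: mult_nonpos_nonneg)
    then show ?thesis using le[of x] by simp
  qed
  with sa show "(\<forall>x y. (A *v x) \<bullet> y = x \<bullet> (A *v y)) \<and> (\<forall>x. 0 \<le> x \<bullet> (A *v x))"
    by blast
next
  assume form: "(\<forall>x y. (A *v x) \<bullet> y = x \<bullet> (A *v y)) \<and> (\<forall>x. 0 \<le> x \<bullet> (A *v x))"
  have "c \<in> \<real>\<^sub>\<ge>\<^sub>0" if ev: "mat_eigenvalue A c" for c
  proof -
    obtain v where v: "v \<noteq> 0" "A *v v = c *s v"
      using ev by (auto simp: mat_eigenvalue_def)
    have cv: "w \<bullet> (c *s w) = Re c * (w \<bullet> w)" "(\<i> *s w) \<bullet> (c *s w) = Im c * (w \<bullet> w)"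
      for w :: "complex ^ 'n"
      by (simp_all add: inner_vec_def inner_complex_def sum_distrib_left algebra_simps)
    \<comment> \<open>multiplication by \<open>\<i>\<close> is skew for the real inner product and commutes with \<open>A\<close>\<close>
    have "(\<i> *s v) \<bullet> (A *v v) = (A *v (\<i> *s v)) \<bullet> v"
      using form by metis
    also have "\<dots> = - ((\<i> *s v) \<bullet> (A *v v))"
      by (simp add: mult_vector_smult inner_smult_left inner_commute[of v]) 
    finally have "Im c = 0"
      using v cv(2)[of v] by simp
    moreover have "0 \<le> Re c"
      using v cv(1)[of v] form[THEN conjunct2, rule_format, of v]
      by (simp add: zero_le_mult_iff)
    ultimately show ?thesis by (simp add: complex_nonneg_Reals_iff)
  qed
  then show "positive_mat A"
    using form by (simp add: positive_mat_def hermitian_iff_self_adjoint)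
qed

lemma positive_matI:
  assumes "\<And>x y. (A *v x) \<bullet> y = x \<bullet> (A *v y)" "\<And>x. 0 \<le> x \<bullet> (A *v x)"
  shows "positive_mat A"
  using assms by (simp add: positive_mat_iff_form)

lemma positive_mat_self_adjoint: "positive_mat A \<Longrightarrow> (A *v x) \<bullet> y = x \<bullet> (A *v y)"
  by (simp add: positive_mat_iff_form)

lemma positive_mat_form: "positive_mat A \<Longrightarrow> 0 \<le> x \<bullet> (A *v x)"
  by (simp add: positive_mat_iff_form)

lemma positive_mat_null_vector:
  "positive_mat K \<Longrightarrow> v \<bullet> (K *v v) = 0 \<Longrightarrow> K *v v = 0"
  by (rule null_vector_of_nonneg_form) (simp_all add: positive_mat_iff_form)

lemma positive_mat_zero: "positive_mat 0"
  by (simp add: positive_mat_iff_form)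

lemma positive_mat_add: "positive_mat A \<Longrightarrow> positive_mat B \<Longrightarrow> positive_mat (A + B)"
  by (simp add: positive_mat_iff_form matrix_vector_mult_add_rdistrib inner_add_left inner_add_right)

lemma positive_mat_scaleR: "0 \<le> r \<Longrightarrow> positive_mat A \<Longrightarrow> positive_mat (r *\<^sub>R A)"
  by (simp add: positive_mat_iff_form)

lemma positive_mat_sum: "(\<And>i. i \<in> I \<Longrightarrow> positive_mat (f i)) \<Longrightarrow> positive_mat (\<Sum>i\<in>I. f i)"
  by (induction I rule: infinite_finite_induct) (simp_all add: positive_mat_zero positive_mat_add)

lemma positive_mat_congruence:
  assumes "positive_mat G" "positive_mat S"
  shows "positive_mat (S ** G ** S)"
proof (rule positive_matI)
  fix x y
  show "((S ** G ** S) *v x) \<bullet> y = x \<bullet> ((S ** G ** S) *v y)"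
    using assms by (simp add: positive_mat_self_adjoint flip: matrix_vector_mul_assoc)
  have "x \<bullet> ((S ** G ** S) *v x) = (S *v x) \<bullet> (G *v (S *v x))"
    using assms by (simp add: positive_mat_self_adjoint flip: matrix_vector_mul_assoc)
  then show "0 \<le> x \<bullet> ((S ** G ** S) *v x)"
    using assms(1) by (simp add: positive_mat_form)
qed

section \<open>The positive square root\<close>

definition rank_one :: "complex ^ 'n \<Rightarrow> complex ^ 'n ^ 'n" where
  "rank_one v = (\<chi> i j. v $ i * cnj (v $ j))"

definition hermitian_inner :: "complex ^ 'n \<Rightarrow> complex ^ 'n \<Rightarrow> complex" where
  "hermitian_inner v w = (\<Sum>j\<in>UNIV. cnj (v $ j) * w $ j)"

lemma rank_one_mult_vector: "rank_one v *v w = hermitian_inner v w *s v"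
  by (simp add: rank_one_def hermitian_inner_def matrix_vector_mult_def vec_eq_iff sum_distrib_left mult_ac)

lemma hermitian_inner_self: "hermitian_inner v v = complex_of_real (v \<bullet> v)"
  by (simp add: hermitian_inner_def inner_vec_def inner_complex_def complex_eq_iff algebra_simps)

lemma hermitian_inner_diff_smult:
  "hermitian_inner v (w - c *s u) = hermitian_inner v w - c * hermitian_inner v u"
  by (simp add: hermitian_inner_def algebra_simps sum_subtractf sum_distrib_left)

lemma inner_smult_hermitian_inner:
  "w \<bullet> (hermitian_inner v w *s v) = (cmod (hermitian_inner v w))\<^sup>2"
proof -
  have "w \<bullet> (c *s v) = Re (cnj (hermitian_inner v w) * c)" for c
    unfolding hermitian_inner_def inner_vec_def cnj_sum sum_distrib_right Re_sum
    by (intro sum.cong) (simp_all add: inner_complex_def algebra_simps)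
  then show ?thesis
    by (simp add: cmod_power2 flip: power2_eq_square)
qed

lemma positive_mat_rank_one: "positive_mat (rank_one v)"
proof (rule positive_matI)
  have "hermitian (rank_one v)"
    by (simp add: hermitian_def rank_one_def)
  then show "(rank_one v *v x) \<bullet> y = x \<bullet> (rank_one v *v y)" for x y
    by (simp add: hermitian_iff_self_adjoint)
  show "0 \<le> x \<bullet> (rank_one v *v x)" for x
    by (simp add: rank_one_mult_vector inner_smult_hermitian_inner)
qed

text \<open>
  Splitting off an eigenvector preserves positivity: the difference annihilates \<open>v\<close>, so its form at \<open>w\<close>
  depends only on the component \<open>u\<close> of \<open>w\<close> orthogonal to \<open>v\<close>, where it agrees with the form of \<open>X\<close>.
\<close>

lemma positive_mat_deflate:
  assumes X: "positive_mat X" and v: "norm v = 1" "X *v v = l *\<^sub>R v"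
  shows "positive_mat (X - l *\<^sub>R rank_one v)" and "(X - l *\<^sub>R rank_one v) *v v = 0"
proof -
  let ?Y = "X - l *\<^sub>R rank_one v"
  have vv: "hermitian_inner v v = 1"
    using v(1) by (simp add: hermitian_inner_self dot_square_norm)
  have Y: "?Y *v w = X *v w - l *\<^sub>R (hermitian_inner v w *s v)" for w
    by (simp add: matrix_vector_mult_diff_rdistrib rank_one_mult_vector)
  show Yv: "?Y *v v = 0"
    by (simp add: Y v(2) vv)
  have sa: "(?Y *v x) \<bullet> y = x \<bullet> (?Y *v y)" for x y
    using positive_mat_self_adjoint[OF X, of x y]
      positive_mat_self_adjoint[OF positive_mat_rank_one, of v x y]
    by (simp add: matrix_vector_mult_diff_rdistrib inner_diff_left inner_diff_right)
  show "positive_mat ?Y"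
  proof (rule positive_matI[OF sa])
    fix w
    define u where "u = w - hermitian_inner v w *s v"
    have "?Y *v w = ?Y *v u"
      by (simp add: u_def matrix_vector_mult_diff_distrib mult_vector_smult Yv)
    moreover have "hermitian_inner v u = 0"
      by (simp add: u_def hermitian_inner_diff_smult vv)
    ultimately have "?Y *v w = X *v u"
      by (simp add: Y)
    then have "w \<bullet> (?Y *v w) = u \<bullet> (X *v u)"
      by (metis \<open>?Y *v w = ?Y *v u\<close> inner_commute sa)
    then show "0 \<le> w \<bullet> (?Y *v w)"
      using X by (simp add: positive_mat_form)
  qed
qed

text \<open>
  Splitting off the eigenvector \<open>v\<close> of the largest eigenvalue \<open>l\<close> leaves a positive matrix \<open>Y\<close> whose range
  is smaller: it is orthogonal to \<open>v\<close>, while \<open>v\<close> lies in the range of \<open>X\<close>.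
  A positive root \<open>T\<close> of \<open>Y\<close> annihilates \<open>v\<close>, so \<open>T\<close> and the
  projection onto \<open>v\<close> multiply to \<open>0\<close>, and adding \<open>sqrt l\<close> times the projection to \<open>T\<close> gives a root of \<open>X\<close>.
\<close>

lemma positive_sqrt_exists:
  fixes X :: "complex ^ 'n ^ 'n"
  assumes "positive_mat X"
  shows "\<exists>S. positive_mat S \<and> S ** S = X"
  using assms
proof (induction "dim (range ((*v) X))" arbitrary: X rule: less_induct)
  case less
  show ?case
  proof (cases "X = 0")
    case True
    then have "positive_mat (0 :: complex ^ 'n ^ 'n) \<and> 0 ** 0 = X"
      by (simp add: positive_mat_zero)
    then show ?thesis by blast
  next
    case False
    obtain v l where v: "norm v = 1" "X *v v = l *\<^sub>R v" and le: "\<And>x. x \<bullet> (X *v x) \<le> l * (x \<bullet> x)"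
      using max_eigenvector positive_mat_self_adjoint[OF less.prems] by blast
    have "l \<noteq> 0"
    proof
      assume "l = 0"
      then have "X *v x = 0" for x
        using le[of x] positive_mat_form[OF less.prems, of x]
        by (intro positive_mat_null_vector[OF less.prems]) simp
      with False show False by (simp add: matrix_eq)
    qed
    moreover have "0 \<le> l"
      using positive_mat_form[OF less.prems, of v] v by (simp add: dot_square_norm)
    ultimately have "l > 0" by simp
    define Y where "Y = X - l *\<^sub>R rank_one v"
    have Y: "positive_mat Y" "Y *v v = 0"
      using positive_mat_deflate[OF less.prems v] by (simp_all add: Y_def)
    have v_range: "v \<in> range ((*v) X)"
      using v(2) \<open>l > 0\<close> by (intro range_eqI[of _ _ "inverse l *\<^sub>R v"]) simp
    have sub: "range ((*v) Y) \<subseteq> range ((*v) X)"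
    proof
      fix z assume "z \<in> range ((*v) Y)"
      then obtain w where "z = Y *v w" by blast
      also have "\<dots> = X *v (w - hermitian_inner v w *s v)"
        using v(2) by (simp add: Y_def matrix_vector_mult_diff_rdistrib rank_one_mult_vector
            matrix_vector_mult_diff_distrib mult_vector_smult)
          (simp add: vec_eq_iff)
      finally show "z \<in> range ((*v) X)" by blast
    qed
    have "v \<notin> range ((*v) Y)"
    proof
      assume "v \<in> range ((*v) Y)"
      then obtain w where "v = Y *v w" by blast
      then have "v \<bullet> v = w \<bullet> (Y *v v)"
        by (metis positive_mat_self_adjoint[OF Y(1)])
      with Y(2) v(1) show False by (simp add: dot_square_norm)
    qed
    with v_range sub have "range ((*v) Y) \<subset> range ((*v) X)" by blast
    moreover have "subspace (range ((*v) A))" for A :: "complex ^ 'n ^ 'n"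
      by (intro linear_subspace_image subspace_UNIV) simp
    ultimately have "dim (range ((*v) Y)) < dim (range ((*v) X))"
      by (intro dim_psubset) (simp add: span_eq_iff[THEN iffD2])
    from less.hyps[OF this Y(1)] obtain T where T: "positive_mat T" "T ** T = Y" by blast
    have Tv: "T *v v = 0"
    proof -
      have "(T *v v) \<bullet> (T *v v) = v \<bullet> (Y *v v)"
        by (simp add: positive_mat_self_adjoint[OF T(1)] matrix_vector_mul_assoc T(2))
      then show ?thesis using Y(2) by simp
    qed
    define S where "S = T + sqrt l *\<^sub>R rank_one v"
    have "positive_mat S"
      unfolding S_def using T(1) \<open>l > 0\<close>
      by (intro positive_mat_add positive_mat_scaleR positive_mat_rank_one) simp_all
    moreover have "S ** S = X"
      unfolding matrix_eq
    proof
      fix x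
      have vTx: "rank_one v *v (T *v x) = 0"
      proof -
        let ?r = "rank_one v *v (T *v x)"
        have "?r \<bullet> ?r = x \<bullet> (T *v (rank_one v *v ?r))"
          by (simp add: positive_mat_self_adjoint[OF T(1)]
              positive_mat_self_adjoint[OF positive_mat_rank_one])
        also have "\<dots> = 0"
          by (simp add: rank_one_mult_vector mult_vector_smult Tv)
        finally show ?thesis by simp
      qed
      have "hermitian_inner v v = 1"
        using v(1) by (simp add: hermitian_inner_self dot_square_norm)
      then have idem: "rank_one v *v (rank_one v *v x) = rank_one v *v x"
        by (simp add: rank_one_mult_vector mult_vector_smult)
      have Tr: "T *v (rank_one v *v x) = 0"
        by (simp add: rank_one_mult_vector mult_vector_smult Tv)
      have "(S ** S) *v x = T *v (T *v x) + l *\<^sub>R (rank_one v *v x)"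
        using \<open>l > 0\<close>
        by (simp add: S_def matrix_vector_mult_add_rdistrib matrix_vector_right_distrib vTx Tr idem
            flip: matrix_vector_mul_assoc)
      also have "\<dots> = X *v x"
        by (simp add: matrix_vector_mul_assoc T(2) Y_def matrix_vector_mult_diff_rdistrib)
      finally show "(S ** S) *v x = X *v x" .
    qed
    ultimately show ?thesis by blast
  qed
qed

text \<open>
  If \<open>P\<^sup>2 = Q\<^sup>2\<close>, then \<open>D = Q - P\<close> anticommutes with \<open>P + Q\<close>.  An eigenvector \<open>v\<close> of \<open>D\<close> with a nonzero
  eigenvalue would therefore be a zero of the form of \<open>P + Q\<close>, hence be annihilated by both \<open>P\<close> and
  \<open>Q\<close>, and so by \<open>D\<close>.  Thus the largest eigenvalue of \<open>D\<close> is \<open>0\<close>, and the same holds for \<open>- D\<close>.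
\<close>

lemma positive_sqrt_unique:
  fixes S T :: "complex ^ 'n ^ 'n"
  assumes S: "positive_mat S" and T: "positive_mat T" and eq: "S ** S = T ** T"
  shows "S = T"
proof -
  have eq': "S *v (S *v x) = T *v (T *v x)" for x
    by (simp add: matrix_vector_mul_assoc eq)
  have "0 \<le> x \<bullet> ((P - Q) *v x)"
    if P: "positive_mat P" and Q: "positive_mat Q" and PQ: "\<And>x. P *v (P *v x) = Q *v (Q *v x)"
    for P Q and x :: "complex ^ 'n"
  proof -
    define D where "D = Q - P"
    have D: "D *v x = Q *v x - P *v x" for x
      by (simp add: D_def matrix_vector_mult_diff_rdistrib)
    have sa: "(D *v x) \<bullet> y = x \<bullet> (D *v y)" for x y
      by (simp add: D inner_diff_left inner_diff_right positive_mat_self_adjoint P Q)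
    obtain v d where v: "norm v = 1" "D *v v = d *\<^sub>R v" and le: "\<And>x. x \<bullet> (D *v x) \<le> d * (x \<bullet> x)"
      using max_eigenvector sa by blast
    have "d = 0"
    proof (rule ccontr)
      assume "d \<noteq> 0"
      define p where "p = v \<bullet> (P *v v)"
      define q where "q = v \<bullet> (Q *v v)"
      have "d * (p + q) = v \<bullet> (P *v (D *v v)) + v \<bullet> (Q *v (D *v v))"
        by (simp add: v(2) p_def q_def algebra_simps)
      also have "\<dots> = v \<bullet> (P *v (Q *v v)) - v \<bullet> (Q *v (P *v v))"
        by (simp add: D matrix_vector_mult_diff_distrib inner_diff_right PQ)
      also have "\<dots> = 0"
        by (metis P Q diff_self inner_commute positive_mat_self_adjoint)
      finally have "p + q = 0"
        using \<open>d \<noteq> 0\<close> by simp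
      moreover have "0 \<le> p" "0 \<le> q"
        using P Q by (simp_all add: p_def q_def positive_mat_form)
      ultimately have "P *v v = 0" "Q *v v = 0"
        using P Q by (auto simp: p_def q_def intro!: positive_mat_null_vector)
      with v \<open>d \<noteq> 0\<close> show False by (auto simp: D)
    qed
    with le[of x] show ?thesis
      by (simp add: D matrix_vector_mult_diff_rdistrib inner_diff_right)
  qed
  note nonneg = this
  have "positive_mat (S - T)"
    using nonneg[OF S T eq'] S T
    by (intro positive_matI)
      (simp_all add: matrix_vector_mult_diff_rdistrib inner_diff_left inner_diff_right positive_mat_self_adjoint)
  moreover have "x \<bullet> ((S - T) *v x) = 0" for x
    using nonneg[OF S T eq', of x] nonneg[OF T S eq'[symmetric], of x]
    by (simp add: matrix_vector_mult_diff_rdistrib inner_diff_right)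
  ultimately have "(S - T) *v x = 0" for x
    by (intro positive_mat_null_vector)
  then show ?thesis
    by (simp add: matrix_eq matrix_vector_mult_diff_rdistrib)
qed

lemma
  assumes "positive_mat X"
  shows positive_mat_sqrt: "positive_mat (mat_sqrt X)"
    and mat_sqrt_square: "mat_sqrt X ** mat_sqrt X = X"
proof -
  have "\<exists>!S. positive_mat S \<and> S ** S = X"
    using positive_sqrt_exists[OF assms] positive_sqrt_unique by metis
  from theI'[OF this] show "positive_mat (mat_sqrt X)" "mat_sqrt X ** mat_sqrt X = X"
    unfolding mat_sqrt_def by blast+
qed

section \<open>Bounds for a matrix and its inverse\<close>

text \<open>
  With \<open>w = K z\<close> this follows on adding the nonnegative form of \<open>K\<close> at \<open>d z - w\<close> and that of \<open>d - K\<close> at \<open>w\<close>,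
  and dividing by \<open>d\<close>; for \<open>d = 0\<close> the form of \<open>K\<close> vanishes, and so does \<open>K\<close>.
\<close>

lemma positive_mat_square_le:
  assumes K: "positive_mat K" and L: "positive_mat (d *\<^sub>R mat 1 - K)" and "0 \<le> d"
  shows "(K *v z) \<bullet> (K *v z) \<le> d * (z \<bullet> (K *v z))"
proof (cases "d = 0")
  case True
  then have "z \<bullet> (K *v z) = 0"
    using positive_mat_form[OF K, of z] positive_mat_form[OF L, of z] by simp
  then show ?thesis using positive_mat_null_vector[OF K, of z] by simp
next
  case False
  define w where "w = K *v z"
  have zKw: "z \<bullet> (K *v w) = w \<bullet> w"
    by (metis w_def positive_mat_self_adjoint[OF K])
  have "w \<bullet> (K *v w) \<le> d * (w \<bullet> w)"
    using positive_mat_form[OF L, of w]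
    by (simp add: matrix_vector_mult_diff_rdistrib inner_diff_right)
  moreover have "0 \<le> d * (d * (z \<bullet> w)) - 2 * (d * (w \<bullet> w)) + w \<bullet> (K *v w)"
    using positive_mat_form[OF K, of "d *\<^sub>R z - w"] zKw
    by (simp add: matrix_vector_mult_diff_distrib inner_diff_right inner_diff_left w_def[symmetric]
        algebra_simps)
  ultimately have "0 \<le> d * (d * (z \<bullet> w) - w \<bullet> w)"
    by (simp add: algebra_simps)
  with False \<open>0 \<le> d\<close> show ?thesis
    by (simp add: zero_le_mult_iff w_def)
qed

text \<open>
  Every \<open>x\<close> has the form \<open>S z\<close> with \<open>S\<close> the square root of \<open>A\<close>.  This substitution turns the forms of the
  inverse of \<open>A\<close>, of the identity and of \<open>A\<close> at \<open>x\<close> into those of the identity, of \<open>A\<close> and of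
  \<open>A\<^sup>2\<close> at \<open>z\<close>.  What remains are \<open>m \<le> A \<le> M\<close> and \<open>(A - m) (M - A) \<ge> 0\<close>; the latter is
  \<open>positive_mat_square_le\<close> for \<open>K = A - m\<close> and \<open>d = M - m\<close>.
\<close>

lemma positive_inverse_bounds:
  fixes A :: "complex ^ 'n ^ 'n"
  assumes "0 < m" "m \<le> M" and lower: "m *\<^sub>R mat 1 \<le>\<^sub>L A" and upper: "A \<le>\<^sub>L M *\<^sub>R mat 1"
  shows "positive_mat (matrix_inv A)"
    and "positive_mat (mat 1 - m *\<^sub>R matrix_inv A)"
    and "positive_mat (M *\<^sub>R matrix_inv A - mat 1)"
    and "positive_mat ((m + M) *\<^sub>R mat 1 - (m * M) *\<^sub>R matrix_inv A - A)"
proof -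
  let ?K = "A - m *\<^sub>R mat 1"
  have K: "positive_mat ?K" and L: "positive_mat (M *\<^sub>R mat 1 - A)"
    using lower upper by (simp_all add: loewner_le_def)
  have "positive_mat (mat 1 :: complex ^ 'n ^ 'n)"
    by (simp add: positive_mat_iff_form)
  then have A: "positive_mat A"
    using positive_mat_add[OF K positive_mat_scaleR[of m "mat 1"]] \<open>0 < m\<close> by simp
  have low: "m * (z \<bullet> z) \<le> z \<bullet> (A *v z)" and up: "z \<bullet> (A *v z) \<le> M * (z \<bullet> z)" for z
    using positive_mat_form[OF K, of z] positive_mat_form[OF L, of z]
    by (simp_all add: matrix_vector_mult_diff_rdistrib inner_diff_right)
  have mid: "(A *v z) \<bullet> (A *v z) \<le> (m + M) * (z \<bullet> (A *v z)) - m * M * (z \<bullet> z)" for z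
  proof -
    have "M *\<^sub>R mat 1 - A = (M - m) *\<^sub>R mat 1 - ?K"
      by (simp add: algebra_simps)
    with L have L': "positive_mat ((M - m) *\<^sub>R mat 1 - ?K)" by simp
    have "(?K *v z) \<bullet> (?K *v z) \<le> (M - m) * (z \<bullet> (?K *v z))"
      using \<open>m \<le> M\<close> by (intro positive_mat_square_le K L') simp
    then show ?thesis
      by (simp add: matrix_vector_mult_diff_rdistrib inner_diff_right inner_diff_left
          inner_commute algebra_simps)
  qed
  have "A *v x = 0 \<Longrightarrow> x = 0" for x
    using low[of x] \<open>0 < m\<close> by (simp add: mult_le_0_iff)
  then have "invertible A"
    by (simp add: invertible_left_inverse matrix_left_invertible_ker)
  then have "A ** matrix_inv A = mat 1 \<and> matrix_inv A ** A = mat 1"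
    unfolding invertible_def matrix_inv_def by (rule someI_ex)
  then have AG: "A *v (matrix_inv A *v x) = x" and GA: "matrix_inv A *v (A *v x) = x" for x
    by (simp_all add: matrix_vector_mul_assoc)
  have saG: "(matrix_inv A *v x) \<bullet> y = x \<bullet> (matrix_inv A *v y)" for x y
    by (metis AG positive_mat_self_adjoint[OF A])
  define S where "S = mat_sqrt A"
  have S: "(S *v x) \<bullet> y = x \<bullet> (S *v y)" for x y
    using positive_mat_self_adjoint[OF positive_mat_sqrt[OF A]] by (simp add: S_def)
  have SS: "S *v (S *v x) = A *v x" for x
    using mat_sqrt_square[OF A] by (simp add: S_def matrix_vector_mul_assoc)
  have sub: "\<exists>z. x \<bullet> (matrix_inv A *v x) = z \<bullet> z \<and> x \<bullet> x = z \<bullet> (A *v z)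
      \<and> x \<bullet> (A *v x) = (A *v z) \<bullet> (A *v z)" for x
  proof -
    define z where "z = S *v (matrix_inv A *v x)"
    have Sz: "S *v z = x"
      by (simp add: z_def SS AG)
    have "z \<bullet> z = x \<bullet> (matrix_inv A *v x)"
      by (metis Sz S z_def inner_commute)
    moreover have "x \<bullet> x = z \<bullet> (A *v z)"
      by (metis Sz S SS)
    moreover have "x \<bullet> (A *v x) = (A *v z) \<bullet> (A *v z)"
      by (metis Sz S SS)
    ultimately show ?thesis by metis
  qed
  note [simp] = matrix_vector_mult_diff_rdistrib inner_diff_left inner_diff_right saG
    positive_mat_self_adjoint[OF A]
  show "positive_mat (matrix_inv A)"
    by (rule positive_matI) (simp, metis sub inner_ge_zero)
  show "positive_mat (mat 1 - m *\<^sub>R matrix_inv A)"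
    by (rule positive_matI) (simp, use sub low in \<open>simp, metis\<close>)
  show "positive_mat (M *\<^sub>R matrix_inv A - mat 1)"
    by (rule positive_matI) (simp, use sub up in \<open>simp, metis\<close>)
  show "positive_mat ((m + M) *\<^sub>R mat 1 - (m * M) *\<^sub>R matrix_inv A - A)"
  proof (rule positive_matI)
    fix x
    obtain z where z: "x \<bullet> (matrix_inv A *v x) = z \<bullet> z" "x \<bullet> x = z \<bullet> (A *v z)"
      "x \<bullet> (A *v x) = (A *v z) \<bullet> (A *v z)"
      using sub by blast
    show "0 \<le> x \<bullet> (((m + M) *\<^sub>R mat 1 - (m * M) *\<^sub>R matrix_inv A - A) *v x)"
      using mid[of z] by (simp add: z)
  qed simp
qed

text \<open>
  The bounds above are linear in the matrix, its inverse and the identity, so they survive congruence by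
  the square roots of the \<open>X\<^sub>i\<close> and summation; the identity becomes the sum of the \<open>X\<^sub>i\<close>.
\<close>

lemma positive_congruence_sum_bounds:
  fixes A X :: "'i \<Rightarrow> complex ^ 'n ^ 'n"
  assumes "0 < m" "m \<le> M"
    and A: "\<And>i. i \<in> I \<Longrightarrow> m *\<^sub>R mat 1 \<le>\<^sub>L A i \<and> A i \<le>\<^sub>L M *\<^sub>R mat 1"
    and X: "\<And>i. i \<in> I \<Longrightarrow> positive_mat (X i)"
  defines "P \<equiv> (\<Sum>i\<in>I. mat_sqrt (X i) ** A i ** mat_sqrt (X i))"
    and "P' \<equiv> (\<Sum>i\<in>I. mat_sqrt (X i) ** matrix_inv (A i) ** mat_sqrt (X i))"
    and "U \<equiv> (\<Sum>i\<in>I. X i)"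
  shows "positive_mat P'" "positive_mat (U - m *\<^sub>R P')" "positive_mat (M *\<^sub>R P' - U)"
    "positive_mat ((m + M) *\<^sub>R U - (m * M) *\<^sub>R P' - P)"
proof -
  define F where "F i G = mat_sqrt (X i) ** G ** mat_sqrt (X i)" for i G
  have F_diff: "F i (G - H) = F i G - F i H" and F_scaleR: "F i (r *\<^sub>R G) = r *\<^sub>R F i G" for i G H r
    by (simp_all add: F_def matrix_eq matrix_vector_mult_diff_rdistrib
        matrix_vector_mult_diff_distrib flip: matrix_vector_mul_assoc)
  have U: "U = (\<Sum>i\<in>I. F i (mat 1))"
    unfolding U_def F_def by (rule sum.cong) (simp_all add: mat_sqrt_square X)
  have P: "P = (\<Sum>i\<in>I. F i (A i))" and P': "P' = (\<Sum>i\<in>I. F i (matrix_inv (A i)))"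
    by (simp_all add: P_def P'_def F_def)
  have pos: "positive_mat (\<Sum>i\<in>I. F i (G i))" if "\<And>i. i \<in> I \<Longrightarrow> positive_mat (G i)" for G
    unfolding F_def using that X
    by (intro positive_mat_sum positive_mat_congruence positive_mat_sqrt) auto
  note bounds = positive_inverse_bounds[OF \<open>0 < m\<close> \<open>m \<le> M\<close>]
  note expand = U P P' F_diff F_scaleR sum_subtractf scaleR_sum_right
  show "positive_mat P'"
    unfolding P' using A by (intro pos bounds(1)) auto
  have "positive_mat (\<Sum>i\<in>I. F i (mat 1 - m *\<^sub>R matrix_inv (A i)))"
    using A by (intro pos bounds(2)) auto
  then show "positive_mat (U - m *\<^sub>R P')"
    by (simp add: expand)
  have "positive_mat (\<Sum>i\<in>I. F i (M *\<^sub>R matrix_inv (A i) - mat 1))"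
    using A by (intro pos bounds(3)) auto
  then show "positive_mat (M *\<^sub>R P' - U)"
    by (simp add: expand)
  have "positive_mat (\<Sum>i\<in>I. F i ((m + M) *\<^sub>R mat 1 - (m * M) *\<^sub>R matrix_inv (A i) - A i))"
    using A by (intro pos bounds(4)) auto
  then show "positive_mat ((m + M) *\<^sub>R U - (m * M) *\<^sub>R P' - P)"
    by (simp add: expand)
qed

section \<open>The operator inequality\<close>

lemma multilinear_map_imp_bilinear:
  assumes "multilinear_map \<Phi>"
  shows "bilinear \<Phi>"
proof -
  have scale: "r *\<^sub>R G = mat_scale (complex_of_real r) G" for r and G :: "complex ^ 'c ^ 'c"
    by (simp add: mat_scale_def vec_eq_iff scaleR_conv_of_real[where 'a=complex])
  have "Vector_Spaces.linear mat_scale mat_scale f \<Longrightarrow> linear f"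
    for f :: "complex ^ 'a ^ 'a \<Rightarrow> complex ^ 'b ^ 'b"
    by (simp add: Vector_Spaces.linear_iff Real_Vector_Spaces.linear_iff scale)
  then show ?thesis
    using assms unfolding multilinear_map_def bilinear_def by blast
qed

theorem proposition4p1:
  fixes \<Phi> :: "complex ^ 'q ^ 'q \<Rightarrow> complex ^ 'q ^ 'q \<Rightarrow> complex ^ 'p ^ 'p"
    and m M :: real
    and n :: nat
    and A B X Y :: "nat \<Rightarrow> complex ^ 'q ^ 'q"
  assumes "unital_map \<Phi>" and "positive_map \<Phi>" and "multilinear_map \<Phi>"
    and "0 < m" and "m \<le> M"
    and "\<And>i. i \<in> {1..n} \<Longrightarrow> positive_mat (A i)"
    and "\<And>i. i \<in> {1..n} \<Longrightarrow> positive_mat (B i)"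
    and "\<And>i. i \<in> {1..n} \<Longrightarrow> m *\<^sub>R mat 1 \<le>\<^sub>L A i \<and> A i \<le>\<^sub>L M *\<^sub>R mat 1"
    and "\<And>i. i \<in> {1..n} \<Longrightarrow> m *\<^sub>R mat 1 \<le>\<^sub>L B i \<and> B i \<le>\<^sub>L M *\<^sub>R mat 1"
    and "\<And>i. i \<in> {1..n} \<Longrightarrow> positive_mat (X i)"
    and "\<And>i. i \<in> {1..n} \<Longrightarrow> positive_mat (Y i)"
  shows "\<Phi> (\<Sum>i=1..n. mat_sqrt (X i) ** A i ** mat_sqrt (X i))
           (\<Sum>i=1..n. mat_sqrt (Y i) ** matrix_inv (B i) ** mat_sqrt (Y i))
       + \<Phi> (\<Sum>i=1..n. mat_sqrt (X i) ** matrix_inv (A i) ** mat_sqrt (X i))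
           (\<Sum>i=1..n. mat_sqrt (Y i) ** B i ** mat_sqrt (Y i))
       \<le>\<^sub>L ((m\<^sup>2 + M\<^sup>2) / (m * M)) *\<^sub>R \<Phi> (\<Sum>i=1..n. X i) (\<Sum>i=1..n. Y i)"
proof -
  define P where "P = (\<Sum>i=1..n. mat_sqrt (X i) ** A i ** mat_sqrt (X i))"
  define P' where "P' = (\<Sum>i=1..n. mat_sqrt (X i) ** matrix_inv (A i) ** mat_sqrt (X i))"
  define U where "U = (\<Sum>i=1..n. X i)"
  define Q where "Q = (\<Sum>i=1..n. mat_sqrt (Y i) ** B i ** mat_sqrt (Y i))"
  define Q' where "Q' = (\<Sum>i=1..n. mat_sqrt (Y i) ** matrix_inv (B i) ** mat_sqrt (Y i))"
  define V where "V = (\<Sum>i=1..n. Y i)"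
  note posA = positive_congruence_sum_bounds[of m M "{1..n}" A X,
      OF assms(4,5,8,10), folded P_def P'_def U_def]
  note posB = positive_congruence_sum_bounds[of m M "{1..n}" B Y,
      OF assms(4,5,9,11), folded Q_def Q'_def V_def]
  have bil: "bilinear \<Phi>"
    using assms(3) by (rule multilinear_map_imp_bilinear)
  have pos: "positive_mat (\<Phi> G H)" if "positive_mat G" "positive_mat H" for G H
    using assms(2) that by (simp add: positive_map_def)
  \<comment> \<open>the four summands of the scalar identity, in the same order\<close>
  have "positive_mat
     (\<Phi> ((m + M) *\<^sub>R U - (m * M) *\<^sub>R P' - P) Q'
      + \<Phi> P' ((m + M) *\<^sub>R V - (m * M) *\<^sub>R Q' - Q)
      + (M / m) *\<^sub>R \<Phi> (U - m *\<^sub>R P') (V - m *\<^sub>R Q')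
      + (m / M) *\<^sub>R \<Phi> (M *\<^sub>R P' - U) (M *\<^sub>R Q' - V))" (is "positive_mat ?R")
    using assms(4,5) by (intro positive_mat_add positive_mat_scaleR pos posA posB) simp_all
  also have "?R = ((m\<^sup>2 + M\<^sup>2) / (m * M)) *\<^sub>R \<Phi> U V - (\<Phi> P Q' + \<Phi> P' Q)"
  proof -
    have "M > 0" using assms(4,5) by simp
    with \<open>0 < m\<close> show ?thesis
      unfolding bilinear_lsub[OF bil] bilinear_rsub[OF bil] bilinear_lmul[OF bil] bilinear_rmul[OF bil]
      by (simp add: vec_eq_iff complex_eq_iff field_simps power2_eq_square)
  qed
  finally show ?thesis
    unfolding loewner_le_def P_def P'_def U_def Q_def Q'_def V_def .
qed

end
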